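(* For every $a\ge1$, $b\ge2$ and $n\ge1$, the graph $G_{a,b,n}=\overline{K}_a\nabla(nB_b)$ is neither vertex decomposable nor shellable.
   Context: All graphs are finite, simple and undirected. For $b\ge 2$, $B_b$ is the graph with vertices $x_1,\dots,x_b,y_1,\dots,y_b$ and edges $\{x_i,x_j\}$ and $\{y_i,y_j\}$ for $1\le i<j\le b$, and $\{x_i,y_i\}$ for $1\le i\le b$. $nB_b$ is the disjoint union of $n$ copies of $B_b$. The join $G\nabla H$ of graphs on disjoint vertex sets is obtained from the disjoint union by adding every edge between $V(G)$ and $V(H)$. $\overline{K}_a$ is the edgeless graph on $a$ vertices. A graph $G$ is called shellable (resp. vertex decomposable) if its independence complex $\Delta(G)$, the simplicial complex of all independent sets of $G$, is shellable (resp. vertex decomposable). *)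

theory Defs
  imports Main
begin

section \<open>Graphs\<close>

record 'v ugraph =
  verts :: "'v set"
  edges :: "'v set set"

definition simple_graph :: "'v ugraph \<Rightarrow> bool" where
  "simple_graph G \<longleftrightarrow>
     finite (verts G) \<and> (\<forall>e\<in>edges G. e \<subseteq> verts G \<and> card e = 2)"

definition edgeless :: "nat \<Rightarrow> nat ugraph" where
  "edgeless a = \<lparr>verts = {1..a}, edges = {}\<rparr>"

text \<open>The vertex \<open>x\<^sub>i\<close> of \<open>B\<^sub>b\<close> is \<open>Inl i\<close>, and \<open>y\<^sub>i\<close> is \<open>Inr i\<close>.\<close>

definition B_graph :: "nat \<Rightarrow> (nat + nat) ugraph" where
  "B_graph b =
     \<lparr>verts = Inl ` {1..b} \<union> Inr ` {1..b},
      edges = {{Inl i, Inl j} | i j. 1 \<le> i \<and> i < j \<and> j \<le> b}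
            \<union> {{Inr i, Inr j} | i j. 1 \<le> i \<and> i < j \<and> j \<le> b}
            \<union> {{Inl i, Inr i} | i. 1 \<le> i \<and> i \<le> b}\<rparr>"

definition copies :: "nat \<Rightarrow> 'v ugraph \<Rightarrow> (nat \<times> 'v) ugraph" where
  "copies n G =
     \<lparr>verts = {1..n} \<times> verts G,
      edges = {Pair k ` e | k e. k \<in> {1..n} \<and> e \<in> edges G}\<rparr>"

text \<open>The sum type makes the two vertex sets disjoint.\<close>

definition graph_join :: "'u ugraph \<Rightarrow> 'v ugraph \<Rightarrow> ('u + 'v) ugraph"  (infixr \<open>\<nabla>\<close> 65) where
  "G \<nabla> H =
     \<lparr>verts = Inl ` verts G \<union> Inr ` verts H,
      edges = (image Inl) ` edges G \<union> (image Inr) ` edges H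
            \<union> {{Inl u, Inr w} | u w. u \<in> verts G \<and> w \<in> verts H}\<rparr>"

definition G_graph :: "nat \<Rightarrow> nat \<Rightarrow> nat \<Rightarrow> (nat + (nat \<times> (nat + nat))) ugraph" where
  "G_graph a b n = edgeless a \<nabla> copies n (B_graph b)"

lemma simple_graph_edgeless: "simple_graph (edgeless a)"
  by (simp add: simple_graph_def edgeless_def)

lemma simple_graph_B_graph: "simple_graph (B_graph b)"
  by (auto simp: simple_graph_def B_graph_def card_insert_if)

lemma simple_graph_copies:
  assumes "simple_graph G"
  shows "simple_graph (copies n G)"
proof -
  have "card (Pair k ` e) = card e" for k :: nat and e :: "'a set"
    by (rule card_image) (simp add: inj_on_def)
  then show ?thesis
    using assms by (fastforce simp: simple_graph_def copies_def)
qed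

lemma simple_graph_join:
  assumes "simple_graph G" "simple_graph H"
  shows "simple_graph (G \<nabla> H)"
proof -
  have "card (Inl ` e :: ('a + 'b) set) = card e" for e
    by (rule card_image) simp
  moreover have "card (Inr ` e :: ('a + 'b) set) = card e" for e
    by (rule card_image) simp
  ultimately show ?thesis
    using assms by (fastforce simp: simple_graph_def graph_join_def card_insert_if)
qed

lemma simple_graph_G_graph: "simple_graph (G_graph a b n)"
  unfolding G_graph_def
  by (intro simple_graph_join simple_graph_edgeless simple_graph_copies simple_graph_B_graph)


section \<open>Simplicial complexes\<close>

text \<open>A finite abstract simplicial complex is given by its set of faces.\<close>

definition simplicial_complex :: "'v set set \<Rightarrow> bool" where
  "simplicial_complex \<Delta> \<longleftrightarrow>
     finite \<Delta> \<and> {} \<in> \<Delta> \<and> (\<forall>F\<in>\<Delta>. finite F \<and> (\<forall>G. G \<subseteq> F \<longrightarrow> G \<in> \<Delta>))"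

definition facets :: "'v set set \<Rightarrow> 'v set set" where
  "facets \<Delta> = {F \<in> \<Delta>. \<forall>G\<in>\<Delta>. F \<subseteq> G \<longrightarrow> F = G}"

definition pure :: "'v set set \<Rightarrow> bool" where
  "pure \<Delta> \<longleftrightarrow> (\<forall>F\<in>facets \<Delta>. \<forall>G\<in>facets \<Delta>. card F = card G)"

text \<open>
  Shellability and vertex decomposability are the classical, pure notions (vertex decomposability
  as introduced by Provan and Billera), not the nonpure generalisations of Bjoerner and Wachs.
  With the latter the result would fail for \<open>a = 1\<close> and \<open>b \<ge> 3\<close>: for instance,
  with \<open>a = 1\<close>, \<open>b = 3\<close>, \<open>n = 1\<close> the independence complex is a hexagon together with an isolated
  point, which is both shellable and vertex decomposable in the nonpure sense.
\<close>

text \<open>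
  The intersection of the facet \<open>Fs ! j\<close> with the subcomplex generated by the preceding facets
  has to be pure of dimension \<open>dim (Fs ! j) - 1\<close>.
\<close>

definition shelling :: "'v set set \<Rightarrow> 'v set list \<Rightarrow> bool" where
  "shelling \<Delta> Fs \<longleftrightarrow>
     distinct Fs \<and> set Fs = facets \<Delta> \<and>
     (\<forall>j. 0 < j \<and> j < length Fs \<longrightarrow>
        (\<forall>H \<in> facets (Pow (Fs ! j) \<inter> (\<Union>i<j. Pow (Fs ! i))). card H + 1 = card (Fs ! j)))"

definition shellable :: "'v set set \<Rightarrow> bool" where
  "shellable \<Delta> \<longleftrightarrow> pure \<Delta> \<and> (\<exists>Fs. shelling \<Delta> Fs)"

definition deletion :: "'v \<Rightarrow> 'v set set \<Rightarrow> 'v set set" where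
  "deletion v \<Delta> = {F \<in> \<Delta>. v \<notin> F}"

definition link :: "'v \<Rightarrow> 'v set set \<Rightarrow> 'v set set" where
  "link v \<Delta> = {F. v \<notin> F \<and> insert v F \<in> \<Delta>}"

text \<open>
  For a pure complex, the condition on facets in the second rule says that the deletion is pure of
  the same dimension. The first rule includes the complex \<open>{{}}\<close>.
\<close>

inductive vertex_decomposable :: "'v set set \<Rightarrow> bool" where
  simplex: "finite F \<Longrightarrow> vertex_decomposable (Pow F)"
| shedding: "pure \<Delta> \<Longrightarrow> v \<in> \<Union>\<Delta> \<Longrightarrow> facets (deletion v \<Delta>) \<subseteq> facets \<Delta> \<Longrightarrow>
    vertex_decomposable (deletion v \<Delta>) \<Longrightarrow> vertex_decomposable (link v \<Delta>) \<Longrightarrow>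
    vertex_decomposable \<Delta>"


section \<open>The independence complex of a graph\<close>

definition independence_complex :: "'v ugraph \<Rightarrow> 'v set set" where
  "independence_complex G = {S. S \<subseteq> verts G \<and> (\<forall>e\<in>edges G. \<not> e \<subseteq> S)}"

lemma simplicial_complex_independence_complex:
  assumes "simple_graph G"
  shows "simplicial_complex (independence_complex G)"
proof -
  have "independence_complex G \<subseteq> Pow (verts G)" "finite (verts G)"
    using assms by (auto simp: independence_complex_def simple_graph_def)
  moreover from this have "finite (independence_complex G)"
    by (meson finite_Pow_iff finite_subset)
  moreover have "{} \<in> independence_complex G"
    using assms by (auto simp: independence_complex_def simple_graph_def)
  moreover have down: "H \<in> independence_complex G"
    if "F \<in> independence_complex G" "H \<subseteq> F" for F H
    using that unfolding independence_complex_def by blast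
  ultimately show ?thesis
    unfolding simplicial_complex_def
    by (meson PowD finite_subset subset_trans down subsetD)
qed

definition shellable_graph :: "'v ugraph \<Rightarrow> bool" where
  "shellable_graph G \<longleftrightarrow> shellable (independence_complex G)"

definition vertex_decomposable_graph :: "'v ugraph \<Rightarrow> bool" where
  "vertex_decomposable_graph G \<longleftrightarrow> vertex_decomposable (independence_complex G)"

end

theory Submission
  imports Defs
begin

text \<open>
  A pure complex of positive dimension that is shellable or vertex decomposable is connected. In a
  shelling of a disconnected complex, the first facet lying in another component than the initial
  one meets its predecessors only in the empty face, so it is a single vertex. In the vertex
  decomposable case, deleting a shedding vertex preserves the facet sizes, hence by induction
  it must destroy disconnectedness; then the deleted vertex was isolated, i.e. a facet of
  size one. The independence complex of a join is disconnected, and here it has an edge, given by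
  \<open>x\<^sub>1\<close> and \<open>y\<^sub>2\<close> in one copy of \<open>B\<^sub>b\<close>.
\<close>

text \<open>The sets \<open>U\<close> and \<open>W\<close> need not consist of vertices of the
  complex; each only has to meet its vertex set \<open>\<Union>\<Delta>\<close>. So the same pair
  can be kept while vertices are deleted, and for a join it can be the two ranges of the sum
  type.\<close>

definition disconnection :: "'v set set \<Rightarrow> 'v set \<Rightarrow> 'v set \<Rightarrow> bool" where
  "disconnection \<Delta> U W \<longleftrightarrow>
     U \<inter> W = {} \<and> (\<forall>F\<in>\<Delta>. F \<subseteq> U \<or> F \<subseteq> W) \<and> U \<inter> \<Union>\<Delta> \<noteq> {} \<and> W \<inter> \<Union>\<Delta> \<noteq> {}"

lemma disconnection_sym: "disconnection \<Delta> U W \<Longrightarrow> disconnection \<Delta> W U"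
  by (simp add: disconnection_def Int_commute disj_commute)

lemma face_in_facet:
  assumes "simplicial_complex \<Delta>" "F \<in> \<Delta>"
  obtains G where "G \<in> facets \<Delta>" "F \<subseteq> G"
proof -
  have "finite \<Delta>"
    using assms(1) by (simp add: simplicial_complex_def)
  from finite_has_maximal2[OF this assms(2)] obtain G
    where "G \<in> \<Delta>" "F \<subseteq> G" "\<forall>H\<in>\<Delta>. G \<subseteq> H \<longrightarrow> G = H"
    by blast
  then have "G \<in> facets \<Delta>"
    by (simp add: facets_def)
  then show thesis
    using \<open>F \<subseteq> G\<close> by (rule that)
qed

text \<open>A facet above \<open>E\<close> has at least as many elements as \<open>E\<close>, and
  purity carries its size over to \<open>F\<close>.\<close>

lemma pure_facets_card_ge_2:
  assumes "simplicial_complex \<Delta>" "pure \<Delta>" "E \<in> \<Delta>" "card E \<ge> 2" "F \<in> facets \<Delta>"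
  shows "card F \<ge> 2"
proof -
  obtain G where G: "G \<in> facets \<Delta>" "E \<subseteq> G"
    using face_in_facet[OF assms(1,3)] .
  then have "finite G"
    using assms(1) by (simp add: facets_def simplicial_complex_def)
  then have "card E \<le> card G"
    using G(2) by (rule card_mono)
  also have "card G = card F"
    using assms(2,5) G(1) unfolding pure_def by blast
  finally show ?thesis
    using assms(4) by simp
qed

lemma disconnection_no_shelling_from:
  assumes "simplicial_complex \<Delta>" "disconnection \<Delta> U W" "\<And>F. F \<in> facets \<Delta> \<Longrightarrow> card F \<ge> 2"
    and sh: "shelling \<Delta> Fs" and "Fs ! 0 \<subseteq> U"
  shows False
proof -
  have UW: "U \<inter> W = {}" "\<And>F. F \<in> \<Delta> \<Longrightarrow> F \<subseteq> U \<or> F \<subseteq> W"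
    using assms(2) by (auto simp: disconnection_def)
  have facets: "set Fs = facets \<Delta>"
    using sh by (simp add: shelling_def)
  obtain F where "F \<in> \<Delta>" "F \<inter> W \<noteq> {}"
    using assms(2) unfolding disconnection_def by blast
  moreover from this(1) obtain G where "G \<in> facets \<Delta>" "F \<subseteq> G"
    by (rule face_in_facet[OF assms(1)])
  ultimately have "G \<in> facets \<Delta>" "G \<inter> W \<noteq> {}"
    by auto
  with facets obtain k where "k < length Fs" "Fs ! k \<inter> W \<noteq> {}"
    by (metis in_set_conv_nth)
  with UW have ex: "k < length Fs \<and> \<not> Fs ! k \<subseteq> U"
    by blast
  \<comment> \<open>The first facet of the shelling that leaves the side of the initial one.\<close>
  define j where "j = (LEAST k. k < length Fs \<and> \<not> Fs ! k \<subseteq> U)"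
  have j: "j < length Fs" "\<not> Fs ! j \<subseteq> U"
    using LeastI[of "\<lambda>k. k < length Fs \<and> \<not> Fs ! k \<subseteq> U", OF ex] by (simp_all add: j_def)
  have before: "Fs ! i \<subseteq> U" if "i < j" for i
    using not_less_Least[OF that[unfolded j_def]] that j(1) by simp
  have "j > 0"
    using j(2) assms(5) by (cases j) auto
  have Fj: "Fs ! j \<in> facets \<Delta>"
    using j(1) facets nth_mem by blast
  then have "Fs ! j \<subseteq> W"
    using j(2) UW(2) by (auto simp: facets_def)
  \<comment> \<open>A common face lies in both \<open>U\<close> and \<open>W\<close>. As
    \<open>j > 0\<close>, the union below is over a nonempty range and does contain the empty
    face.\<close>
  then have "H = {}" if "H \<subseteq> Fs ! j" "i < j" "H \<subseteq> Fs ! i" for H i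
    using that before[OF \<open>i < j\<close>] UW(1) by blast
  then have "Pow (Fs ! j) \<inter> (\<Union>i<j. Pow (Fs ! i)) = {{}}"
    using \<open>j > 0\<close> by blast
  then have "{} \<in> facets (Pow (Fs ! j) \<inter> (\<Union>i<j. Pow (Fs ! i)))"
    by (simp add: facets_def)
  then have "card ({} :: 'a set) + 1 = card (Fs ! j)"
    using sh j(1) \<open>j > 0\<close> unfolding shelling_def by blast
  then show False
    using assms(3)[OF Fj] by simp
qed

lemma disconnection_not_shellable:
  assumes "simplicial_complex \<Delta>" "disconnection \<Delta> U W" "E \<in> \<Delta>" "card E \<ge> 2"
  shows "\<not> shellable \<Delta>"
proof
  assume "shellable \<Delta>"
  then obtain Fs where "pure \<Delta>" and sh: "shelling \<Delta> Fs"
    by (auto simp: shellable_def)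
  then have card: "card F \<ge> 2" if "F \<in> facets \<Delta>" for F
    using pure_facets_card_ge_2[OF assms(1) _ assms(3,4) that] by simp
  have facets: "set Fs = facets \<Delta>"
    using sh by (simp add: shelling_def)
  moreover have "facets \<Delta> \<noteq> {}"
    using face_in_facet[OF assms(1,3)] by blast
  ultimately have "Fs ! 0 \<in> facets \<Delta>"
    by (metis length_greater_0_conv nth_mem set_empty)
  then have "Fs ! 0 \<subseteq> U \<or> Fs ! 0 \<subseteq> W"
    using assms(2) by (auto simp: facets_def disconnection_def)
  then show False
    using disconnection_no_shelling_from[OF assms(1) _ card sh] assms(2) disconnection_sym
    by blast
qed

lemma vertex_decomposable_pure: "vertex_decomposable \<Delta> \<Longrightarrow> pure \<Delta>"
proof (induction rule: vertex_decomposable.induct)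
  case (simplex F)
  have "facets (Pow F) = {F}"
    by (auto simp: facets_def)
  then show ?case
    by (simp add: pure_def)
qed

lemma simplicial_complex_deletion:
  assumes "simplicial_complex \<Delta>"
  shows "simplicial_complex (deletion v \<Delta>)"
  using assms unfolding simplicial_complex_def deletion_def by auto

text \<open>Only the side of \<open>v\<close> could lose its last vertex. As \<open>{v}\<close> is a
  face but not a facet, \<open>v\<close> shares a face with another vertex, which lies on the same
  side and survives.\<close>

lemma disconnection_deletion:
  assumes "simplicial_complex \<Delta>" "disconnection \<Delta> U W" "v \<in> U" "v \<in> \<Union>\<Delta>" "{v} \<notin> facets \<Delta>"
  shows "disconnection (deletion v \<Delta>) U W"
proof -
  have down: "G \<in> \<Delta>" if "F \<in> \<Delta>" "G \<subseteq> F" for F G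
    using assms(1) that by (auto simp: simplicial_complex_def)
  have UW: "U \<inter> W = {}" "\<And>F. F \<in> \<Delta> \<Longrightarrow> F \<subseteq> U \<or> F \<subseteq> W"
    using assms(2) by (auto simp: disconnection_def)
  \<comment> \<open>Every vertex other than \<open>v\<close> survives, because its singleton is a
    face avoiding \<open>v\<close>.\<close>
  have single: "u \<in> \<Union>(deletion v \<Delta>)" if "F \<in> \<Delta>" "u \<in> F" "u \<noteq> v" for F u
    using down[of F "{u}"] that by (auto simp: deletion_def)
  have "{v} \<in> \<Delta>"
    using assms(4) down by auto
  then obtain F where F: "F \<in> \<Delta>" "v \<in> F" "F \<noteq> {v}"
    using assms(5) by (auto simp: facets_def)
  then obtain u where "u \<in> F" "u \<noteq> v"
    by blast
  with F have "U \<inter> \<Union>(deletion v \<Delta>) \<noteq> {}"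
    using single UW assms(3) by blast
  moreover obtain F' w where "F' \<in> \<Delta>" "w \<in> F'" "w \<in> W"
    using assms(2) by (auto simp: disconnection_def)
  then have "W \<inter> \<Union>(deletion v \<Delta>) \<noteq> {}"
    using single[of F' w] UW(1) assms(3) by blast
  moreover have "deletion v \<Delta> \<subseteq> \<Delta>"
    by (auto simp: deletion_def)
  ultimately show ?thesis
    using UW unfolding disconnection_def by blast
qed

text \<open>The size bound on facets is what the induction carries: the shedding condition makes the
  facets of the deletion facets of \<open>\<Delta>\<close>, so the bound passes to the
  deletion.\<close>

lemma vertex_decomposable_facets_no_disconnection:
  assumes "vertex_decomposable \<Delta>" "simplicial_complex \<Delta>"
    and "\<And>F. F \<in> facets \<Delta> \<Longrightarrow> card F \<ge> 2"
  shows "\<not> disconnection \<Delta> U W"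
  using assms
proof (induction rule: vertex_decomposable.induct)
  case (simplex F)
  \<comment> \<open>The simplex has all its vertices in the single face \<open>F\<close>, which lies
    on one side and leaves the other side empty.\<close>
  then show ?case
    unfolding disconnection_def by blast
next
  case (shedding \<Delta> v)
  have del: "\<not> disconnection (deletion v \<Delta>) U W"
    using shedding by (meson simplicial_complex_deletion subsetD)
  have "{v} \<notin> facets \<Delta>"
    using shedding.prems(2)[of "{v}"] by auto
  show ?case
  proof
    assume dis: "disconnection \<Delta> U W"
    then have "v \<in> U \<or> v \<in> W"
      using shedding.hyps(2) unfolding disconnection_def by blast
    \<comment> \<open>General \<open>X\<close> and \<open>Y\<close> cover both positions of
      \<open>v\<close>; for \<open>v \<in> W\<close> the two sides are swapped.\<close>
    moreover have "disconnection (deletion v \<Delta>) X Y" if "disconnection \<Delta> X Y" "v \<in> X" for X Y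
      using shedding.prems(1) that shedding.hyps(2) \<open>{v} \<notin> facets \<Delta>\<close>
      by (rule disconnection_deletion)
    ultimately show False
      using del dis disconnection_sym by blast
  qed
qed

lemma disconnection_not_vertex_decomposable:
  assumes "simplicial_complex \<Delta>" "disconnection \<Delta> U W" "E \<in> \<Delta>" "card E \<ge> 2"
  shows "\<not> vertex_decomposable \<Delta>"
proof
  assume vd: "vertex_decomposable \<Delta>"
  have "card F \<ge> 2" if "F \<in> facets \<Delta>" for F
    using assms(1) vertex_decomposable_pure[OF vd] assms(3,4) that by (rule pure_facets_card_ge_2)
  then show False
    using vertex_decomposable_facets_no_disconnection[OF vd assms(1)] assms(2) by blast
qed

text \<open>A face meeting both sides would contain an edge added by the join. Both sides are
  inhabited because singletons of vertices are independent.\<close>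

lemma independence_complex_join_disconnection:
  assumes "simple_graph G" "simple_graph H" "verts G \<noteq> {}" "verts H \<noteq> {}"
  shows "disconnection (independence_complex (G \<nabla> H)) (range Inl) (range Inr)"
proof -
  have simple: "simple_graph (G \<nabla> H)"
    using assms(1,2) by (rule simple_graph_join)
  have single: "{z} \<in> independence_complex (G \<nabla> H)" if "z \<in> verts (G \<nabla> H)" for z
  proof -
    have "\<not> e \<subseteq> {z}" if "e \<in> edges (G \<nabla> H)" for e
      \<comment> \<open>An edge inside a singleton would have at most one element instead of
        two.\<close>
      using simple that card_mono[of "{z}" e] by (auto simp: simple_graph_def)
    then show ?thesis
      using that by (simp add: independence_complex_def)
  qed
  have "F \<subseteq> range Inl \<or> F \<subseteq> range Inr" if F: "F \<in> independence_complex (G \<nabla> H)" for F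
  proof (rule ccontr)
    assume "\<not> (F \<subseteq> range Inl \<or> F \<subseteq> range Inr)"
    then obtain u w where uw: "Inl u \<in> F" "Inr w \<in> F"
      by (metis old.sum.exhaust rangeI subsetI)
    then have "u \<in> verts G" "w \<in> verts H"
      using F by (auto simp: independence_complex_def graph_join_def)
    then have "{Inl u, Inr w} \<in> edges (G \<nabla> H)"
      by (auto simp: graph_join_def)
    then show False
      using F uw by (auto simp: independence_complex_def)
  qed
  moreover obtain u w where "u \<in> verts G" "w \<in> verts H"
    using assms(3,4) by blast
  then have "Inl u \<in> \<Union>(independence_complex (G \<nabla> H))" "Inr w \<in> \<Union>(independence_complex (G \<nabla> H))"
    using single[of "Inl u"] single[of "Inr w"] by (auto simp: graph_join_def)
  ultimately show ?thesis
    by (auto simp: disconnection_def)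
qed

text \<open>Inside one copy, an \<open>x\<close> and a \<open>y\<close> are adjacent only if their
  indices agree; \<open>b \<ge> 2\<close> provides the second index.\<close>

lemma G_graph_independent_pair:
  assumes "b \<ge> 2" "n \<ge> 1"
  shows "{Inr (1, Inl 1), Inr (1, Inr 2)} \<in> independence_complex (G_graph a b n)"
    (is "?E \<in> _")
proof -
  have "\<not> e \<subseteq> ?E" if "e \<in> edges (G_graph a b n)" for e
    using that
    by (auto simp: G_graph_def graph_join_def copies_def B_graph_def edgeless_def)
  then show ?thesis
    using assms
    by (auto simp: independence_complex_def G_graph_def graph_join_def copies_def B_graph_def)
qed

theorem theorem6p5:
  fixes a b n :: nat
  assumes "a \<ge> 1" and "b \<ge> 2" and "n \<ge> 1"
  shows "\<not> vertex_decomposable_graph (G_graph a b n) \<and> \<not> shellable_graph (G_graph a b n)"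
proof -
  let ?\<Delta> = "independence_complex (G_graph a b n)"
  have complex: "simplicial_complex ?\<Delta>"
    by (intro simplicial_complex_independence_complex simple_graph_G_graph)
  have "verts (edgeless a) \<noteq> {}" "verts (copies n (B_graph b)) \<noteq> {}"
    using assms by (auto simp: edgeless_def copies_def B_graph_def)
  then have dis: "disconnection ?\<Delta> (range Inl) (range Inr)"
    unfolding G_graph_def
    by (intro independence_complex_join_disconnection simple_graph_edgeless simple_graph_copies
        simple_graph_B_graph)
  have E: "{Inr (1, Inl 1), Inr (1, Inr 2)} \<in> ?\<Delta>"
    using assms(2,3) by (rule G_graph_independent_pair)
  show ?thesis
    unfolding vertex_decomposable_graph_def shellable_graph_def
    using disconnection_not_vertex_decomposable[OF complex dis E]
      disconnection_not_shellable[OF complex dis E] by simp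
qed

end
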